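(* Let $T$ be a locally finite tree with a fixed root at infinity, in which every vertex has at least two successors, and let $m$ be a flow measure on $T$ with $C_m:=\sup_{x\in T}\frac{m(p(x))}{m(x)}<\infty$; put $D_m:=\sup_{x\in T}\frac{m(x)}{m(p(x))}$. Let $k_a,k_b,k_d>0$ and $k_c>1$, and let $\sigma_i(n)=k_i^n$ for $n\in\mathbb Z$, $i\in\{a,b,c,d\}$. Assume that there is a constant $C>0$ with $m(x)\le C\left(\frac{k_c}{k_ak_b}\right)^{\ell(x)}$ for every $x\in T$, and that $D_m<k_ak_d<\frac{k_c}{C_m}$. Then $\mathcal V_{a,b,c}$ is bounded on $L^1(m\cdot\sigma_d)$.
   Context: Tree notation. $T$ is an infinite locally finite tree with graph distance $d$ and a fixed reference vertex $o$. The boundary $\partial T$ is the set of equivalence classes of infinite geodesics starting at $o$ (two being equivalent if they eventually coincide). Fix $\omega\in\partial T$ (the root at infinity); let $[o,\omega)=\{x_n\}_{n\ge0}$ be the geodesic ray from $o$ (with $x_0=o$) representing $\omega$. The level is $\ell(x)=\lim_{n\to\infty}(n-d(x,x_n))$. For each vertex $x$, $p(x)$ is the unique neighbour with $\ell(p(x))=\ell(x)+1$, and $s(x)$ is the set of the other neighbours (successors). $p^0(x)=x$, $p^n(x)=p(p^{n-1}(x))$; $s_0(x)=\{x\}$, $s_n(x)=\bigcup_{y\in s_{n-1}(x)}s(y)$. $T_x=\bigcup_{n\ge0}s_n(x)$ and $\dot T_x=T_x\setminus\{x\}$. A flow measure is a function $m:T\to(0,\infty)$ with $m(x)=\sum_{y\in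 s(x)}m(y)$ for all $x$. Each $\sigma_i$ is also viewed as a function on $T$ via $\sigma_i(x)=\sigma_i(\ell(x))$, and $m\cdot\sigma_i$ is the measure on $T$ giving mass $m(x)\sigma_i(x)$ to the vertex $x$. For $n\in\mathbb Z$, $x\in T$, set $S_{n,x}(\sigma_c)=\sum_{k=0}^\infty\sigma_c(\ell(x)+n-k)$. For $v,z,x\in T$ set $\Psi(v,z,x)=0$ if $\{x,z\}\not\subset\dot T_v$; $\Psi(v,z,x)=\frac1{m(y)}-\frac1{m(v)}$ if $\{x,z\}\subset T_y$ for some $y\in s(v)$; and $\Psi(v,z,x)=-\frac1{m(v)}$ otherwise. The Bergman kernel of $L^2(m\cdot\sigma_c)$ is $$K_c(x,y)=\sum_{n=0}^\infty\frac{\Psi(p^{n+1}(x),p^n(x),y)}{S_{n,x}(\sigma_c)},\qquad x,y\in T.$$ The operator $\mathcal V_{a,b,c}$ is $$\mathcal V_{a,b,c}f(x)=m(x)\sigma_a(x)\sum_{y\in T}|K_c(x,y)|f(y)m(y)\sigma_b(y).$$ It is bounded on $L^1(m\cdot\sigma_d)$ if there is a constant $C'$ such that for every $f\in L^1(m\cdot\sigma_d)$ the series converges absolutely for every $x$ and $\|\mathcal V_{a,b,c}f\|_{L^1(m\cdot\sigma_d)}\le C'\|f\|_{L^1(m\cdot\sigma_d)}$. *)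

theory Defs
  imports "HOL-Analysis.Analysis"
begin

text \<open>The vertex set is the whole type \<open>'v\<close>; a graph on it is given by its adjacency relation.\<close>

definition is_cycle :: "('v \<Rightarrow> 'v \<Rightarrow> bool) \<Rightarrow> 'v list \<Rightarrow> bool" where
  "is_cycle E xs \<longleftrightarrow>
     3 \<le> length xs \<and> distinct xs \<and> successively E xs \<and> E (last xs) (hd xs)"

definition is_tree :: "('v \<Rightarrow> 'v \<Rightarrow> bool) \<Rightarrow> bool" where
  "is_tree E \<longleftrightarrow>
     symp E \<and> irreflp E \<and> (\<forall>x y. E\<^sup>*\<^sup>* x y) \<and> (\<nexists>xs. is_cycle E xs)"

definition locally_finite :: "('v \<Rightarrow> 'v \<Rightarrow> bool) \<Rightarrow> bool" where
  "locally_finite E \<longleftrightarrow> (\<forall>x. finite {y. E x y})"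

definition gdist :: "('v \<Rightarrow> 'v \<Rightarrow> bool) \<Rightarrow> 'v \<Rightarrow> 'v \<Rightarrow> nat" where
  "gdist E x y = (LEAST n. (E ^^ n) x y)"

definition geodesic_rays :: "('v \<Rightarrow> 'v \<Rightarrow> bool) \<Rightarrow> 'v \<Rightarrow> (nat \<Rightarrow> 'v) set" where
  "geodesic_rays E x\<^sub>0 =
     {g. g 0 = x\<^sub>0 \<and> (\<forall>i j. i \<le> j \<longrightarrow> gdist E (g i) (g j) = j - i)}"

text \<open>Rays issuing from the same vertex need no index shift when compared eventually.\<close>

definition ray_equiv :: "('v \<Rightarrow> 'v \<Rightarrow> bool) \<Rightarrow> 'v \<Rightarrow> ((nat \<Rightarrow> 'v) \<times> (nat \<Rightarrow> 'v)) set" where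
  "ray_equiv E x\<^sub>0 = {(g, h). g \<in> geodesic_rays E x\<^sub>0 \<and> h \<in> geodesic_rays E x\<^sub>0 \<and>
     eventually (\<lambda>n. g n = h n) sequentially}"

definition tree_boundary :: "('v \<Rightarrow> 'v \<Rightarrow> bool) \<Rightarrow> 'v \<Rightarrow> (nat \<Rightarrow> 'v) set set" where
  "tree_boundary E x\<^sub>0 = geodesic_rays E x\<^sub>0 // ray_equiv E x\<^sub>0"

text \<open>In a tree, equivalent geodesic rays from the same vertex are equal, so a boundary point
  is a singleton and the description below picks its representative \<open>[x\<^sub>0, \<omega>)\<close>. The reference
  vertex is therefore encoded in \<open>\<omega>\<close> and is not a separate argument from here on.\<close>

definition ray_to :: "(nat \<Rightarrow> 'v) set \<Rightarrow> nat \<Rightarrow> 'v" where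
  "ray_to \<omega> = (THE g. g \<in> \<omega>)"

definition level :: "('v \<Rightarrow> 'v \<Rightarrow> bool) \<Rightarrow> (nat \<Rightarrow> 'v) set \<Rightarrow> 'v \<Rightarrow> int" where
  "level E \<omega> x = lim (\<lambda>n. int n - int (gdist E x (ray_to \<omega> n)))"

definition parent :: "('v \<Rightarrow> 'v \<Rightarrow> bool) \<Rightarrow> (nat \<Rightarrow> 'v) set \<Rightarrow> 'v \<Rightarrow> 'v" where
  "parent E \<omega> x = (THE y. E x y \<and> level E \<omega> y = level E \<omega> x + 1)"

definition succs :: "('v \<Rightarrow> 'v \<Rightarrow> bool) \<Rightarrow> (nat \<Rightarrow> 'v) set \<Rightarrow> 'v \<Rightarrow> 'v set" where
  "succs E \<omega> x = {y. E x y} - {parent E \<omega> x}"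

primrec nth_succs :: "('v \<Rightarrow> 'v \<Rightarrow> bool) \<Rightarrow> (nat \<Rightarrow> 'v) set \<Rightarrow> nat \<Rightarrow> 'v \<Rightarrow> 'v set" where
  "nth_succs E \<omega> 0 x = {x}"
| "nth_succs E \<omega> (Suc n) x = (\<Union>y\<in>nth_succs E \<omega> n x. succs E \<omega> y)"

definition subtree :: "('v \<Rightarrow> 'v \<Rightarrow> bool) \<Rightarrow> (nat \<Rightarrow> 'v) set \<Rightarrow> 'v \<Rightarrow> 'v set" where
  "subtree E \<omega> x = (\<Union>n. nth_succs E \<omega> n x)"

definition punctured_subtree :: "('v \<Rightarrow> 'v \<Rightarrow> bool) \<Rightarrow> (nat \<Rightarrow> 'v) set \<Rightarrow> 'v \<Rightarrow> 'v set" where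
  "punctured_subtree E \<omega> x = subtree E \<omega> x - {x}"

definition flow_measure ::
    "('v \<Rightarrow> 'v \<Rightarrow> bool) \<Rightarrow> (nat \<Rightarrow> 'v) set \<Rightarrow> ('v \<Rightarrow> real) \<Rightarrow> bool" where
  "flow_measure E \<omega> m \<longleftrightarrow> (\<forall>x. 0 < m x \<and> m x = (\<Sum>y\<in>succs E \<omega> x. m y))"

definition weighted_measure ::
    "('v \<Rightarrow> 'v \<Rightarrow> bool) \<Rightarrow> (nat \<Rightarrow> 'v) set \<Rightarrow> ('v \<Rightarrow> real) \<Rightarrow> (int \<Rightarrow> real) \<Rightarrow> 'v measure" where
  "weighted_measure E \<omega> m \<sigma> = point_measure UNIV (\<lambda>x. ennreal (m x * \<sigma> (level E \<omega> x)))"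

definition S_sum ::
    "('v \<Rightarrow> 'v \<Rightarrow> bool) \<Rightarrow> (nat \<Rightarrow> 'v) set \<Rightarrow> (int \<Rightarrow> real) \<Rightarrow> int \<Rightarrow> 'v \<Rightarrow> real" where
  "S_sum E \<omega> \<sigma> n x = (\<Sum>k. \<sigma> (level E \<omega> x + n - int k))"

text \<open>The subtrees of distinct successors are disjoint, so the description below is unambiguous.\<close>

definition Psi ::
    "('v \<Rightarrow> 'v \<Rightarrow> bool) \<Rightarrow> (nat \<Rightarrow> 'v) set \<Rightarrow> ('v \<Rightarrow> real) \<Rightarrow> 'v \<Rightarrow> 'v \<Rightarrow> 'v \<Rightarrow> real" where
  "Psi E \<omega> m v z x =
     (if \<not> {x, z} \<subseteq> punctured_subtree E \<omega> v then 0
      else if \<exists>y\<in>succs E \<omega> v. {x, z} \<subseteq> subtree E \<omega> y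
      then 1 / m (THE y. y \<in> succs E \<omega> v \<and> {x, z} \<subseteq> subtree E \<omega> y) - 1 / m v
      else - 1 / m v)"

definition bergman_kernel ::
    "('v \<Rightarrow> 'v \<Rightarrow> bool) \<Rightarrow> (nat \<Rightarrow> 'v) set \<Rightarrow> ('v \<Rightarrow> real) \<Rightarrow> (int \<Rightarrow> real) \<Rightarrow> 'v \<Rightarrow> 'v \<Rightarrow> real" where
  "bergman_kernel E \<omega> m \<sigma> x y =
     (\<Sum>n. Psi E \<omega> m ((parent E \<omega> ^^ (n + 1)) x) ((parent E \<omega> ^^ n) x) y
            / S_sum E \<omega> \<sigma> (int n) x)"

definition V_summand ::
    "('v \<Rightarrow> 'v \<Rightarrow> bool) \<Rightarrow> (nat \<Rightarrow> 'v) set \<Rightarrow> ('v \<Rightarrow> real) \<Rightarrow> (int \<Rightarrow> real) \<Rightarrow> (int \<Rightarrow> real) \<Rightarrow>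
     ('v \<Rightarrow> complex) \<Rightarrow> 'v \<Rightarrow> 'v \<Rightarrow> complex" where
  "V_summand E \<omega> m \<sigma>b \<sigma>c f x y =
     of_real \<bar>bergman_kernel E \<omega> m \<sigma>c x y\<bar> * f y * of_real (m y * \<sigma>b (level E \<omega> y))"

definition V_op ::
    "('v \<Rightarrow> 'v \<Rightarrow> bool) \<Rightarrow> (nat \<Rightarrow> 'v) set \<Rightarrow> ('v \<Rightarrow> real) \<Rightarrow>
     (int \<Rightarrow> real) \<Rightarrow> (int \<Rightarrow> real) \<Rightarrow> (int \<Rightarrow> real) \<Rightarrow> ('v \<Rightarrow> complex) \<Rightarrow> 'v \<Rightarrow> complex" where
  "V_op E \<omega> m \<sigma>a \<sigma>b \<sigma>c f x =
     of_real (m x * \<sigma>a (level E \<omega> x)) * (\<Sum>\<^sub>\<infinity>y. V_summand E \<omega> m \<sigma>b \<sigma>c f x y)"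

text \<open>Membership of the image in \<open>L\<^sup>1\<close> is demanded separately, because the Bochner integral of a
  non-integrable function is \<open>0\<close>.\<close>

definition V_bounded_on_L1 ::
    "('v \<Rightarrow> 'v \<Rightarrow> bool) \<Rightarrow> (nat \<Rightarrow> 'v) set \<Rightarrow> ('v \<Rightarrow> real) \<Rightarrow>
     (int \<Rightarrow> real) \<Rightarrow> (int \<Rightarrow> real) \<Rightarrow> (int \<Rightarrow> real) \<Rightarrow> (int \<Rightarrow> real) \<Rightarrow> bool" where
  "V_bounded_on_L1 E \<omega> m \<sigma>a \<sigma>b \<sigma>c \<sigma>d \<longleftrightarrow>
     (let M = weighted_measure E \<omega> m \<sigma>d in
      \<exists>C'. \<forall>f :: 'v \<Rightarrow> complex. integrable M f \<longrightarrow>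
        (\<forall>x. (\<lambda>y. norm (V_summand E \<omega> m \<sigma>b \<sigma>c f x y)) summable_on UNIV) \<and>
        integrable M (V_op E \<omega> m \<sigma>a \<sigma>b \<sigma>c f) \<and>
        (\<integral>x. norm (V_op E \<omega> m \<sigma>a \<sigma>b \<sigma>c f x) \<partial>M) \<le> C' * (\<integral>x. norm (f x) \<partial>M))"

end

theory Submission
  imports Defs
begin

text \<open>
  On \<open>L\<^sup>1\<close> a positive integral operator is bounded as soon as the weighted sums of the columns of its
  kernel are dominated by the weight (\<open>L1_boundedness_by_column_sums\<close>). With \<open>r = ka * kd\<close> and
  \<open>\<kappa>\<close> the Bergman kernel, this asks for a bound on the sum over \<open>x\<close> of
  \<open>(m x)\<^sup>2 * r powi lev x * \<bar>\<kappa> x y\<bar>\<close> by a multiple of \<open>(kd / kb) powi lev y\<close>.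

  The absolute value of the kernel is controlled by the lowest common ancestor \<open>v\<close> of \<open>x\<close> and \<open>y\<close>
  alone: it is at most \<open>kc / (m v * kc powi lev v)\<close> (\<open>bergman_kernel_bound\<close>). It remains to sum
  \<open>(m x)\<^sup>2 * r powi lev x\<close> over the descendants \<open>x\<close> of \<open>v\<close> and then the result over the ancestors \<open>v\<close> of
  \<open>y\<close>. Both sums are dominated by geometric series. Going down one generation costs a factor
  \<open>D / r\<close> with \<open>D\<close> the supremum of \<open>m x / m (p x)\<close> (\<open>subtree_weight_bound\<close>), and going up one
  generation costs a factor \<open>K * r / kc\<close> with \<open>K\<close> the supremum of \<open>m (p x) / m x\<close>
  (\<open>kernel_column_bound\<close>); the condition \<open>D < r < kc / K\<close> says that both ratios are less than 1.
  What is left is a multiple of \<open>m y * (r / kc) powi lev y\<close>, and the growth condition on \<open>m\<close> bounds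
  this by a multiple of \<open>(kd / kb) powi lev y\<close>.

  All this rests on a description of the tree by the parent map: every edge joins a vertex to its
  parent, one level higher, and the subtree of \<open>v\<close> consists of the vertices that iterated parents lead
  to \<open>v\<close>. This follows from the fact that, for every target \<open>w\<close>, all neighbours of a vertex but at most
  one are farther from \<open>w\<close> (\<open>unique_nonascending_neighbour\<close>), applied to targets far out on the
  ray that represents \<open>\<omega>\<close>.
\<close>

section \<open>Distances in a tree\<close>

text \<open>Every time the walk returns to a vertex, the loop in between can be cut out.\<close>

lemma rtranclp_imp_path:
  assumes "R\<^sup>*\<^sup>* y z"
  obtains xs where "xs \<noteq> []" "hd xs = y" "last xs = z" "distinct xs" "successively R xs"
  using assms
proof (induction arbitrary: thesis rule: converse_rtranclp_induct)
  case base
  show ?case by (rule base[of "[z]"]) auto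
next
  case (step a b)
  obtain xs where xs: "xs \<noteq> []" "hd xs = b" "last xs = z" "distinct xs" "successively R xs"
    using step.IH by blast
  show ?case
  proof (cases "a \<in> set xs")
    case True
    then obtain us vs where "xs = us @ a # vs" by (meson split_list)
    with xs show ?thesis
      by (intro step.prems[of "a # vs"]) (auto simp: successively_append_iff)
  next
    case False
    with xs step.hyps show ?thesis
      by (intro step.prems[of "a # xs"]) (auto simp: successively_Cons)
  qed
qed

locale tree =
  fixes E :: "'v \<Rightarrow> 'v \<Rightarrow> bool"
  assumes is_tree: "is_tree E"
begin

lemma edge_sym: "E x y \<Longrightarrow> E y x"
  using is_tree by (auto simp: is_tree_def dest: sympD)

lemma edge_irrefl: "\<not> E x x"
  using is_tree by (auto simp: is_tree_def dest: irreflpD)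

lemma connected: "E\<^sup>*\<^sup>* x y"
  using is_tree by (auto simp: is_tree_def)

lemma no_cycle: "\<not> is_cycle E xs"
  using is_tree by (auto simp: is_tree_def)

lemma gdist_walk: "(E ^^ gdist E x y) x y"
  unfolding gdist_def by (rule LeastI_ex) (use connected rtranclp_imp_relpowp in metis)

lemma gdist_le: "(E ^^ n) x y \<Longrightarrow> gdist E x y \<le> n"
  unfolding gdist_def by (rule Least_le)

lemma walk_sym: "(E ^^ n) x y \<Longrightarrow> (E ^^ n) y x"
proof (induction n arbitrary: y)
  case (Suc n)
  then obtain z where "(E ^^ n) x z" "E z y" by (auto elim: relpowp_Suc_E)
  with Suc.IH show ?case by (blast intro: relpowp_Suc_I2 edge_sym)
qed auto

lemma gdist_commute: "gdist E x y = gdist E y x"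
  by (meson antisym gdist_le gdist_walk walk_sym)

lemma gdist_triangle: "gdist E x z \<le> gdist E x y + gdist E y z"
proof (rule gdist_le)
  show "(E ^^ (gdist E x y + gdist E y z)) x z"
    unfolding relpowp_add using gdist_walk by blast
qed

lemma gdist_eq_0_iff: "gdist E x y = 0 \<longleftrightarrow> x = y"
  using gdist_walk[of x y] gdist_le[of 0 x y] by auto

lemma gdist_edge: "E x y \<Longrightarrow> gdist E x y = 1"
proof -
  assume e: "E x y"
  then have "gdist E x y \<le> 1" by (intro gdist_le) (simp add: eq_OO)
  moreover have "gdist E x y \<noteq> 0"
    using e edge_irrefl by (auto simp: gdist_eq_0_iff)
  ultimately show ?thesis by simp
qed

lemma gdist_eq_1_imp_edge: "gdist E x y = 1 \<Longrightarrow> E x y"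
  using gdist_walk[of x y] by (simp add: eq_OO)

lemma gdist_edge_le: "E x y \<Longrightarrow> gdist E x w \<le> Suc (gdist E y w)"
  using gdist_triangle[of x w y] gdist_edge[of x y] by simp

lemma descending_neighbour:
  assumes "gdist E x w \<noteq> 0"
  obtains y where "E x y" and "gdist E x w = Suc (gdist E y w)"
proof -
  obtain n where n: "gdist E x w = Suc n"
    using assms not0_implies_Suc by blast
  then obtain y where y: "E x y" "(E ^^ n) y w"
    using gdist_walk[of x w] by (metis relpowp_Suc_D2)
  then have "gdist E y w \<le> n" by (simp add: gdist_le)
  with y n gdist_edge_le[of x y w] show thesis by (intro that[of y]) auto
qed

lemma walk_avoiding_vertex:
  assumes "gdist E y w \<le> gdist E x w" and "y \<noteq> x"
  shows "(\<lambda>a b. E a b \<and> a \<noteq> x \<and> b \<noteq> x)\<^sup>*\<^sup>* y w"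
  using assms
proof (induction "gdist E y w" arbitrary: y)
  case 0
  then show ?case by (simp add: gdist_eq_0_iff)
next
  case (Suc n)
  obtain u where u: "E y u" "gdist E y w = Suc (gdist E u w)"
    using descending_neighbour[of y w] Suc.hyps(2) by (metis nat.distinct(1))
  then have "u \<noteq> x" using Suc.prems by auto
  then have "(\<lambda>a b. E a b \<and> a \<noteq> x \<and> b \<noteq> x)\<^sup>*\<^sup>* u w"
    using Suc u by auto
  moreover have "E y u \<and> y \<noteq> x \<and> u \<noteq> x" using u Suc.prems \<open>u \<noteq> x\<close> by simp
  ultimately show ?case by (rule converse_rtranclp_into_rtranclp[rotated])
qed

text \<open>Acyclicity enters here and nowhere else. Geodesics from \<open>y\<close> and \<open>z\<close> to \<open>w\<close> start no farther from
  \<open>w\<close> than \<open>x\<close> is and then come closer, so they avoid \<open>x\<close>; if \<open>y \<noteq> z\<close>, they would close up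
  through \<open>x\<close> to a cycle.\<close>

lemma unique_nonascending_neighbour:
  assumes "E x y" "E x z" and y: "gdist E y w \<le> gdist E x w" and z: "gdist E z w \<le> gdist E x w"
  shows "y = z"
proof (rule ccontr)
  assume "y \<noteq> z"
  define R where "R = (\<lambda>a b. E a b \<and> a \<noteq> x \<and> b \<noteq> x)"
  have ne: "y \<noteq> x" "z \<noteq> x" using assms edge_irrefl by auto
  have yw: "R\<^sup>*\<^sup>* y w" and zw: "R\<^sup>*\<^sup>* z w"
    unfolding R_def by (rule walk_avoiding_vertex[OF y ne(1)], rule walk_avoiding_vertex[OF z ne(2)])
  have "symp R" unfolding R_def symp_def using edge_sym by blast
  then have "R\<^sup>*\<^sup>* w z" using zw by (rule sympD[OF symp_rtranclp])
  with yw have "R\<^sup>*\<^sup>* y z" by (rule rtranclp_trans)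
  then obtain xs where xs: "xs \<noteq> []" "hd xs = y" "last xs = z" "distinct xs"
    and walk: "successively R xs"
    by (rule rtranclp_imp_path)
  obtain u vs where uvs: "xs = y # u # vs"
    using xs(1-3) \<open>y \<noteq> z\<close> by (cases xs; cases "tl xs") auto
  have "x \<notin> set ys" if "successively R (a # ys)" for a ys
    using that by (induction ys arbitrary: a) (auto simp: R_def successively_Cons)
  from this[of y "u # vs"] have "x \<notin> set xs" using walk uvs ne by simp
  moreover have "successively E xs"
    using walk by (rule successively_mono) (auto simp: R_def)
  ultimately have "is_cycle E (x # xs)"
    using xs uvs assms(1) edge_sym[OF assms(2)] by (simp add: is_cycle_def successively_Cons)
  then show False by (simp add: no_cycle)
qed

text \<open>Next to the neighbour of \<open>x\<close> on a geodesic to \<open>w\<close>, a neighbour as far from \<open>w\<close> as \<open>x\<close> would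
  be a second one that is not farther away.\<close>

lemma gdist_edge_neq:
  assumes "E x y"
  shows "gdist E y w \<noteq> gdist E x w"
proof
  assume eq: "gdist E y w = gdist E x w"
  show False
  proof (cases "gdist E x w = 0")
    case True
    with eq assms edge_irrefl show False by (metis gdist_eq_0_iff)
  next
    case False
    then obtain z where z: "E x z" "gdist E x w = Suc (gdist E z w)"
      by (rule descending_neighbour)
    with unique_nonascending_neighbour[OF assms z(1), of w] eq show False by simp
  qed
qed

end

section \<open>Levels and parents with respect to a boundary point\<close>

locale tree_at_infinity = tree +
  fixes x\<^sub>0 :: 'v and \<omega> :: "(nat \<Rightarrow> 'v) set"
  assumes boundary_point: "\<omega> \<in> tree_boundary E x\<^sub>0"
begin

text \<open>Towards \<open>x\<^sub>0\<close> there is only one way down from each vertex, so two rays that meet at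
  some index agree at all smaller ones.\<close>

lemma geodesic_rays_eqI:
  assumes g: "g \<in> geodesic_rays E x\<^sub>0" and h: "h \<in> geodesic_rays E x\<^sub>0"
    and ev: "eventually (\<lambda>n. g n = h n) sequentially"
  shows "g = h"
proof -
  have ray: "r 0 = x\<^sub>0" "\<And>k. E (r k) (r (Suc k))" "\<And>k. gdist E (r k) x\<^sub>0 = k"
    if "r \<in> geodesic_rays E x\<^sub>0" for r
  proof -
    show r0: "r 0 = x\<^sub>0" using that by (simp add: geodesic_rays_def)
    have d: "gdist E (r i) (r j) = j - i" if "i \<le> j" for i j
      using that \<open>r \<in> _\<close> by (simp add: geodesic_rays_def)
    show "E (r k) (r (Suc k))" for k
      using d[of k "Suc k"] by (intro gdist_eq_1_imp_edge) simp
    show "gdist E (r k) x\<^sub>0 = k" for k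
      using d[of 0 k] r0 by (simp add: gdist_commute)
  qed
  have down: "g k = h k" if "g (Suc k) = h (Suc k)" for k
  proof (rule unique_nonascending_neighbour[where w = x\<^sub>0])
    show "E (g (Suc k)) (g k)" using ray(2)[OF g] by (rule edge_sym)
    show "E (g (Suc k)) (h k)" unfolding that using ray(2)[OF h] by (rule edge_sym)
  qed (simp_all add: ray(3)[OF g] ray(3)[OF h])
  obtain N where N: "\<And>n. n \<ge> N \<Longrightarrow> g n = h n"
    using ev by (auto simp: eventually_sequentially)
  have "g n = h n" for n
  proof (cases "n \<le> N")
    case True
    then show ?thesis
    proof (induction rule: inc_induct)
      case base
      show ?case using N by simp
    next
      case (step k)
      show ?case using step.IH by (rule down)
    qed
  qed (use N in auto)
  then show ?thesis by blast
qed

lemma ray_to_geodesic: "ray_to \<omega> \<in> geodesic_rays E x\<^sub>0"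
proof -
  obtain g where g: "g \<in> geodesic_rays E x\<^sub>0" and \<omega>: "\<omega> = ray_equiv E x\<^sub>0 `` {g}"
    using boundary_point by (auto simp: tree_boundary_def quotient_def)
  have "h \<in> \<omega> \<longleftrightarrow> h = g" for h
    using g geodesic_rays_eqI[of g h] by (auto simp: \<omega> ray_equiv_def)
  then have "ray_to \<omega> = g" by (simp add: ray_to_def)
  with g show ?thesis by simp
qed

abbreviation lev :: "'v \<Rightarrow> int" where "lev \<equiv> level E \<omega>"
abbreviation p :: "'v \<Rightarrow> 'v" where "p \<equiv> parent E \<omega>"

text \<open>The integers \<open>n - gdist E x (ray_to \<omega> n)\<close> increase with \<open>n\<close> and stay below
  \<open>gdist E x x\<^sub>0\<close>, so the limit that defines the level is attained.\<close>

lemma level_attained: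
  obtains N where "\<And>n. N \<le> n \<Longrightarrow> lev x + int (gdist E x (ray_to \<omega> n)) = int n"
proof -
  let ?g = "ray_to \<omega>"
  have g0: "gdist E x\<^sub>0 (?g n) = n" for n
    using ray_to_geodesic by (auto simp: geodesic_rays_def)
  have step: "gdist E x (?g j) \<le> gdist E x (?g i) + (j - i)" if "i \<le> j" for i j
    using gdist_triangle[of x "?g j" "?g i"] ray_to_geodesic that
    by (auto simp: geodesic_rays_def)
  define f where "f n = gdist E x x\<^sub>0 + gdist E x (?g n) - n" for n
  have lower: "n \<le> gdist E x x\<^sub>0 + gdist E x (?g n)" for n
    using gdist_triangle[of x\<^sub>0 "?g n" x] g0[of n] gdist_commute[of x x\<^sub>0] by simp
  have anti: "f j \<le> f i" if "i \<le> j" for i j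
    using step[OF that] that by (simp add: f_def)
  obtain N where N: "\<And>n. f N \<le> f n"
    using ex_has_least_nat[of "\<lambda>_. True" undefined f] by auto
  have const: "int n - int (gdist E x (?g n)) = int (gdist E x x\<^sub>0) - int (f N)" if "N \<le> n" for n
  proof -
    have "f n = f N" using N anti[OF that] by (simp add: antisym)
    then show ?thesis using lower[of n] by (simp add: f_def)
  qed
  have "lev x = int (gdist E x x\<^sub>0) - int (f N)"
    unfolding level_def
    by (intro limI tendsto_eventually) (use const in \<open>auto simp: eventually_sequentially\<close>)
  with const show thesis by (intro that[of N]) fastforce
qed


text \<open>Far out on the ray, levels of several vertices are negated distances up to a common shift, so
  statements on levels follow from statements on distances to a single vertex.\<close>

lemma levels_attained_far_out:
  assumes "finite A"
  obtains n where "n \<ge> N" "\<And>x. x \<in> A \<Longrightarrow> lev x + int (gdist E x (ray_to \<omega> n)) = int n"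
proof -
  have "eventually (\<lambda>n. lev x + int (gdist E x (ray_to \<omega> n)) = int n) sequentially" for x
    by (rule level_attained[of x]) (auto simp: eventually_sequentially)
  then have "eventually (\<lambda>n. n \<ge> N \<and> (\<forall>x\<in>A. lev x + int (gdist E x (ray_to \<omega> n)) = int n)) sequentially"
    using assms by (intro eventually_conj eventually_ball_finite eventually_ge_at_top) auto
  then show thesis using that by (auto simp: eventually_sequentially)
qed

lemma level_edge:
  assumes "E x y"
  shows "lev y = lev x + 1 \<or> lev x = lev y + 1"
proof -
  obtain n where n: "\<And>v. v \<in> {x, y} \<Longrightarrow> lev v + int (gdist E v (ray_to \<omega> n)) = int n"
    by (rule levels_attained_far_out[of "{x, y}" 0]) auto
  show ?thesis
    using n[of x] n[of y] gdist_edge_le[OF assms, of "ray_to \<omega> n"]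
      gdist_edge_le[OF edge_sym[OF assms], of "ray_to \<omega> n"]
      gdist_edge_neq[OF assms, of "ray_to \<omega> n"] by auto
qed

lemma unique_higher_neighbour:
  assumes "E x y" "E x z" "lev y = lev x + 1" "lev z = lev x + 1"
  shows "y = z"
proof -
  obtain n where n: "\<And>v. v \<in> {x, y, z} \<Longrightarrow> lev v + int (gdist E v (ray_to \<omega> n)) = int n"
    by (rule levels_attained_far_out[of "{x, y, z}" 0]) auto
  show ?thesis
    using assms n[of x] n[of y] n[of z]
    by (intro unique_nonascending_neighbour[of x y z "ray_to \<omega> n"]) auto
qed

text \<open>A neighbour one step closer to a far point of the ray is higher, because continuing along
  the ray keeps it at least one step ahead.\<close>

lemma higher_neighbour_exists: "\<exists>y. E x y \<and> lev y = lev x + 1"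
proof -
  let ?g = "ray_to \<omega>"
  obtain n where n: "n \<ge> Suc (nat (lev x))" "lev x + int (gdist E x (?g n)) = int n"
    by (rule levels_attained_far_out[of "{x}"]) auto
  then have "gdist E x (?g n) \<noteq> 0" by auto
  then obtain y where y: "E x y" "gdist E x (?g n) = Suc (gdist E y (?g n))"
    by (rule descending_neighbour)
  obtain k where k: "k \<ge> n" "lev y + int (gdist E y (?g k)) = int k"
    by (rule levels_attained_far_out[of "{y}"]) auto
  have "gdist E y (?g k) \<le> gdist E y (?g n) + (k - n)"
    using gdist_triangle[of y "?g k" "?g n"] ray_to_geodesic k(1)
    by (auto simp: geodesic_rays_def)
  then have "lev y \<ge> lev x + 1" using n y(2) k by linarith
  then show ?thesis using level_edge[OF y(1)] y(1) by auto
qed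

lemma ex1_higher_neighbour: "\<exists>!y. E x y \<and> lev y = lev x + 1"
  using higher_neighbour_exists unique_higher_neighbour by blast

lemma edge_parent: "E x (p x)" and level_parent: "lev (p x) = lev x + 1"
  using theI'[OF ex1_higher_neighbour, of x] by (auto simp: parent_def)

lemma edge_cases:
  assumes "E x y"
  shows "y = p x \<or> x = p y"
  using level_edge[OF assms] unique_higher_neighbour assms edge_sym edge_parent level_parent
  by metis

lemma in_succs_iff: "y \<in> succs E \<omega> x \<longleftrightarrow> p y = x"
proof -
  have "p (p y) \<noteq> y"
    using level_parent[of y] level_parent[of "p y"] by auto
  then show ?thesis
    using edge_cases[of x y] edge_parent[of y] edge_sym[of y x] by (auto simp: succs_def)
qed

lemma level_ancestor: "lev ((p ^^ n) x) = lev x + int n"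
  by (induction n) (auto simp: level_parent)

lemma in_nth_succs_iff: "y \<in> nth_succs E \<omega> n x \<longleftrightarrow> (p ^^ n) y = x"
  by (induction n arbitrary: y) (auto simp: in_succs_iff funpow_swap1)

lemma in_subtree_iff: "y \<in> subtree E \<omega> x \<longleftrightarrow> (\<exists>n. (p ^^ n) y = x)"
  by (auto simp: subtree_def in_nth_succs_iff)

lemma subtree_parent: "y \<in> subtree E \<omega> x \<Longrightarrow> y \<in> subtree E \<omega> (p x)"
  unfolding in_subtree_iff by (auto intro: exI[of _ "Suc _"])

lemma subtree_ancestor_mono:
  "i \<le> j \<Longrightarrow> y \<in> subtree E \<omega> ((p ^^ i) x) \<Longrightarrow> y \<in> subtree E \<omega> ((p ^^ j) x)"
  by (induction rule: dec_induct) (auto dest: subtree_parent)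

lemma level_le_of_subtree: "y \<in> subtree E \<omega> x \<Longrightarrow> lev y \<le> lev x"
  by (auto simp: in_subtree_iff level_ancestor)

text \<open>Along a path from \<open>x\<close> to \<open>y\<close> every edge leads to a parent or to a child; in the first case the
  ancestor of \<open>x\<close> may have to be replaced by its parent, in the second it can be kept.\<close>

lemma common_ancestor_exists: "\<exists>n. y \<in> subtree E \<omega> ((p ^^ n) x)"
  using connected[of x y]
proof (induction rule: rtranclp_induct)
  case base
  show ?case by (rule exI[of _ 0]) (auto simp: in_subtree_iff intro: exI[of _ 0])
next
  case (step y z)
  then obtain n where n: "y \<in> subtree E \<omega> ((p ^^ n) x)" by blast
  from edge_cases[OF step.hyps(2)] show ?case
  proof
    assume z: "z = p y"
    from n obtain k where k: "(p ^^ k) y = (p ^^ n) x" by (auto simp: in_subtree_iff)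
    then have "(p ^^ k) z = (p ^^ Suc n) x" using z by (simp flip: funpow_swap1)
    then show ?thesis unfolding in_subtree_iff by blast
  next
    assume "y = p z"
    moreover from n obtain k where "(p ^^ k) y = (p ^^ n) x" by (auto simp: in_subtree_iff)
    ultimately have "(p ^^ Suc k) z = (p ^^ n) x" by (simp add: funpow_swap1)
    then show ?thesis unfolding in_subtree_iff by blast
  qed
qed

end

section \<open>Positive operators on a weighted sequence space\<close>

lemma ennreal_term_le_suminf: "f n \<le> (\<Sum>n. f n)" for f :: "nat \<Rightarrow> ennreal"
  using sum_le_suminf[of f "{n}"] by simp

text \<open>On \<open>L\<^sup>1\<close> only the columns of a nonnegative kernel matter: by Tonelli, the norm of the image is at
  most the sum over \<open>y\<close> of \<open>norm (f y)\<close> times the weighted sum of column \<open>y\<close>. Finiteness of this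
  double sum also makes every single row absolutely convergent, because all weights are
  positive.\<close>

lemma L1_boundedness_by_column_sums:
  fixes w :: "'a \<Rightarrow> real" and k :: "'a \<Rightarrow> 'a \<Rightarrow> real" and f :: "'a \<Rightarrow> complex"
  defines "M \<equiv> point_measure UNIV (\<lambda>x. ennreal (w x))"
  assumes w: "\<And>x. 0 < w x" and k: "\<And>x y. 0 \<le> k x y" and "0 \<le> B"
    and column: "\<And>y. (\<integral>\<^sup>+x. ennreal (w x * k x y) \<partial>count_space UNIV) \<le> ennreal (B * w y)"
    and f: "integrable M f"
  shows "\<And>x. (\<lambda>y. norm (of_real (k x y) * f y)) summable_on UNIV" (is "\<And>x. ?summable x")
    and "integrable M (\<lambda>x. \<Sum>\<^sub>\<infinity>y. of_real (k x y) * f y)" (is ?integrable)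
    and "(\<integral>x. norm (\<Sum>\<^sub>\<infinity>y. of_real (k x y) * f y) \<partial>M) \<le> B * (\<integral>x. norm (f x) \<partial>M)" (is ?bound)
proof -
  let ?op = "\<lambda>x. \<Sum>\<^sub>\<infinity>y. of_real (k x y) * f y"
  let ?C = "count_space (UNIV :: 'a set)"
  have meas: "g \<in> borel_measurable M" for g :: "'a \<Rightarrow> complex"
    by (simp add: M_def)
  have nn_M: "(\<integral>\<^sup>+x. g x \<partial>M) = (\<integral>\<^sup>+x. ennreal (w x) * g x \<partial>?C)" for g
    unfolding M_def point_measure_def by (rule nn_integral_density) simp_all
  let ?row = "\<lambda>x. \<integral>\<^sup>+y. ennreal (k x y * norm (f y)) \<partial>?C"
  have "(\<integral>\<^sup>+x. ?row x \<partial>M) = (\<integral>\<^sup>+x. \<integral>\<^sup>+y. ennreal (w x * k x y * norm (f y)) \<partial>?C \<partial>?C)"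
    using w k by (simp add: nn_M less_imp_le mult.assoc ennreal_mult' flip: nn_integral_cmult)
  also have "\<dots> = (\<integral>\<^sup>+y. \<integral>\<^sup>+x. ennreal (w x * k x y * norm (f y)) \<partial>?C \<partial>?C)"
    using nn_integral_fst_count_space[of "\<lambda>(x, y). ennreal (w x * k x y * norm (f y))"]
      nn_integral_snd_count_space[of "\<lambda>(x, y). ennreal (w x * k x y * norm (f y))"] by simp
  also have "\<dots> = (\<integral>\<^sup>+y. (\<integral>\<^sup>+x. ennreal (w x * k x y) \<partial>?C) * ennreal (norm (f y)) \<partial>?C)"
    by (simp add: ennreal_mult'' nn_integral_multc)
  also have "\<dots> \<le> (\<integral>\<^sup>+y. ennreal (B * w y) * ennreal (norm (f y)) \<partial>?C)"
    using column by (intro nn_integral_mono mult_right_mono) simp_all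
  also have "\<dots> = ennreal B * (\<integral>\<^sup>+y. norm (f y) \<partial>M)"
    using w \<open>0 \<le> B\<close> by (simp add: nn_M ennreal_mult less_imp_le mult.assoc flip: nn_integral_cmult)
  also have "(\<integral>\<^sup>+y. norm (f y) \<partial>M) = ennreal (\<integral>y. norm (f y) \<partial>M)"
    by (rule nn_integral_eq_integral) (use f in auto)
  also have "ennreal B * \<dots> = ennreal (B * (\<integral>y. norm (f y) \<partial>M))"
    using \<open>0 \<le> B\<close> by (simp add: ennreal_mult)
  finally have row: "(\<integral>\<^sup>+x. ?row x \<partial>M) \<le> ennreal (B * (\<integral>y. norm (f y) \<partial>M))" .
  \<comment> \<open>A single vertex has positive mass, so a finite integral makes every single row sum finite.\<close>
  have row_finite: "?row x < \<infinity>" for x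
  proof -
    have "ennreal (w x) * ?row x \<le> (\<integral>\<^sup>+x. ?row x \<partial>M)"
      unfolding nn_M by (rule nn_integral_ge_point) simp
    also have "\<dots> < \<infinity>" using row by (simp add: le_less_trans)
    finally show ?thesis using w[of x] by (auto simp: ennreal_mult_less_top)
  qed
  have integrable_row: "integrable ?C (\<lambda>y. of_real (k x y) * f y)" for x
    using row_finite[of x] k by (simp add: integrable_iff_bounded norm_mult)
  then have abs_summable: "Infinite_Set_Sum.abs_summable_on (\<lambda>y. of_real (k x y) * f y) UNIV" for x
    by (simp add: Infinite_Set_Sum.abs_summable_on_def)
  then show "?summable x" for x
    by (simp only: abs_summable_equivalent)
  have op_le: "ennreal (norm (?op x)) \<le> ?row x" for x
  proof -
    have "?op x = (\<integral>y. of_real (k x y) * f y \<partial>?C)"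
      using infsetsum_infsum[OF abs_summable, of x] by (simp add: infsetsum_def)
    then show ?thesis
      using integral_norm_bound_ennreal[OF integrable_row, of x] k by (simp add: norm_mult)
  qed
  have "(\<integral>\<^sup>+x. norm (?op x) \<partial>M) \<le> (\<integral>\<^sup>+x. ?row x \<partial>M)"
    by (intro nn_integral_mono op_le)
  also note row
  finally have op: "(\<integral>\<^sup>+x. norm (?op x) \<partial>M) \<le> ennreal (B * (\<integral>y. norm (f y) \<partial>M))" .
  then show int: ?integrable
    using meas by (simp add: integrable_iff_bounded le_less_trans)
  have "(\<integral>\<^sup>+x. norm (?op x) \<partial>M) = ennreal (\<integral>x. norm (?op x) \<partial>M)"
    by (rule nn_integral_eq_integral) (use int in auto)
  with op show ?bound
    using \<open>0 \<le> B\<close> by (simp add: ennreal_le_iff)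
qed

section \<open>Decay of the Bergman kernel\<close>

locale flow_tree = tree_at_infinity E x\<^sub>0 \<omega>
  for E :: "'v \<Rightarrow> 'v \<Rightarrow> bool" and x\<^sub>0 :: 'v and \<omega> :: "(nat \<Rightarrow> 'v) set" +
  fixes m :: "'v \<Rightarrow> real"
  assumes flow_measure: "flow_measure E \<omega> m"
begin

lemma m_pos: "0 < m x"
  using flow_measure unfolding flow_measure_def by blast

lemma m_flow: "(\<Sum>y\<in>succs E \<omega> x. m y) = m x"
  using flow_measure unfolding flow_measure_def by metis

text \<open>A sum over an infinite set is 0 by convention, but \<open>m x\<close> is positive.\<close>

lemma finite_succs: "finite (succs E \<omega> x)"
  using m_flow[of x] m_pos[of x] by (metis less_irrefl sum.infinite)

lemma m_le_parent: "m x \<le> m (p x)"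
proof -
  have "m x \<le> (\<Sum>y\<in>succs E \<omega> (p x). m y)"
    by (rule member_le_sum) (auto simp: in_succs_iff finite_succs m_pos less_imp_le)
  then show ?thesis by (simp add: m_flow)
qed

lemma m_ancestor_mono: "i \<le> j \<Longrightarrow> m ((p ^^ i) x) \<le> m ((p ^^ j) x)"
proof (induction rule: dec_induct)
  case (step n)
  have "m ((p ^^ n) x) \<le> m ((p ^^ Suc n) x)" by (simp add: m_le_parent)
  with step.IH show ?case by (rule order_trans)
qed simp

lemma parent_not_in_subtree: "p z \<notin> subtree E \<omega> z"
  using level_le_of_subtree[of "p z" z] by (auto simp: level_parent)

lemma self_in_subtree: "x \<in> subtree E \<omega> x"
  unfolding in_subtree_iff by (auto intro: exI[of _ 0])

lemma Psi_outside: "y \<notin> subtree E \<omega> v \<Longrightarrow> Psi E \<omega> m v z y = 0"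
  by (auto simp: Psi_def punctured_subtree_def)

lemma sibling_subtree_iff:
  assumes "u \<in> succs E \<omega> (p z)"
  shows "z \<in> subtree E \<omega> u \<longleftrightarrow> u = z"
proof
  assume "z \<in> subtree E \<omega> u"
  then obtain k where k: "(p ^^ k) z = u" by (auto simp: in_subtree_iff)
  have "lev (p u) = lev (p z)" using assms by (simp add: in_succs_iff)
  then have "k = 0" using k level_ancestor[of k z] by (simp add: level_parent)
  with k show "u = z" by simp
qed (simp add: self_in_subtree)

text \<open>The only successor of \<open>p z\<close> whose subtree contains \<open>z\<close> is \<open>z\<close> itself, so the three cases that
  define \<open>Psi\<close> depend on the position of \<open>y\<close> alone.\<close>

lemma Psi_parent:
  "Psi E \<omega> m (p z) z y =
     (if y \<notin> punctured_subtree E \<omega> (p z) then 0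
      else if y \<in> subtree E \<omega> z then 1 / m z - 1 / m (p z) else - 1 / m (p z))"
proof -
  have z: "z \<in> punctured_subtree E \<omega> (p z)"
    using subtree_parent[OF self_in_subtree, of z] self_in_subtree[of z] parent_not_in_subtree[of z]
    by (auto simp: punctured_subtree_def)
  have u: "u \<in> succs E \<omega> (p z) \<and> {y, z} \<subseteq> subtree E \<omega> u \<longleftrightarrow> u = z \<and> y \<in> subtree E \<omega> z" for u
    using sibling_subtree_iff[of u z] by (auto simp: in_succs_iff)
  have "y \<in> subtree E \<omega> z \<Longrightarrow> (THE u. u \<in> succs E \<omega> (p z) \<and> {y, z} \<subseteq> subtree E \<omega> u) = z"
    unfolding u by auto
  then show ?thesis
    unfolding Psi_def Bex_def u using z by auto
qed

lemma abs_Psi_le: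
  shows "y \<in> subtree E \<omega> z \<Longrightarrow> \<bar>Psi E \<omega> m (p z) z y\<bar> \<le> 1 / m z"
    and "y \<notin> subtree E \<omega> z \<Longrightarrow> \<bar>Psi E \<omega> m (p z) z y\<bar> \<le> 1 / m (p z)"
proof -
  have "1 / m (p z) \<le> 1 / m z" "0 < 1 / m (p z)" "0 < 1 / m z"
    using m_le_parent[of z] m_pos[of z] m_pos[of "p z"] by (auto simp: field_simps)
  then show "y \<in> subtree E \<omega> z \<Longrightarrow> \<bar>Psi E \<omega> m (p z) z y\<bar> \<le> 1 / m z"
    and "y \<notin> subtree E \<omega> z \<Longrightarrow> \<bar>Psi E \<omega> m (p z) z y\<bar> \<le> 1 / m (p z)"
    by (auto simp: Psi_parent)
qed

lemma S_sum_exponential: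
  assumes k: "1 < k"
  shows "S_sum E \<omega> (\<lambda>n. k powi n) n x = k powi (lev x + n) * (k / (k - 1))"
proof -
  have "k powi (lev x + n - int i) = k powi (lev x + n) * (1 / k) ^ i" for i
    using k by (simp add: power_int_diff power_one_over)
  then have "(\<lambda>i. k powi (lev x + n - int i)) sums (k powi (lev x + n) * (1 / (1 - 1 / k)))"
    using k by (simp only:) (intro sums_mult geometric_sums, simp)
  moreover have "1 / (1 - 1 / k) = k / (k - 1)"
    using k by (simp add: field_simps)
  ultimately show ?thesis by (simp add: S_sum_def sums_iff)
qed

text \<open>Let \<open>v = (p ^^ N) x\<close> be the lowest ancestor of \<open>x\<close> whose subtree contains \<open>y\<close>. The terms of the
  kernel series with \<open>n + 1 < N\<close> vanish, and in each of the others \<open>Psi\<close> is at most \<open>1 / m v\<close> in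
  absolute value, because \<open>m\<close> does not decrease towards \<open>\<omega>\<close>. The denominators grow geometrically, so the remaining terms form a
  geometric series whose value is governed by its beginning near the level of \<open>v\<close>.\<close>

lemma bergman_kernel_bound:
  assumes k: "1 < k"
  obtains N where "y \<in> subtree E \<omega> ((p ^^ N) x)"
    and "\<bar>bergman_kernel E \<omega> m (\<lambda>n. k powi n) x y\<bar>
           \<le> k / (m ((p ^^ N) x) * k powi lev ((p ^^ N) x))"
proof -
  define N where "N = (LEAST n. y \<in> subtree E \<omega> ((p ^^ n) x))"
  have N: "y \<in> subtree E \<omega> ((p ^^ n) x) \<longleftrightarrow> N \<le> n" for n
  proof
    assume "N \<le> n"
    moreover have "y \<in> subtree E \<omega> ((p ^^ N) x)"
      unfolding N_def by (rule LeastI_ex[OF common_ancestor_exists])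
    ultimately show "y \<in> subtree E \<omega> ((p ^^ n) x)" by (rule subtree_ancestor_mono)
  qed (simp add: N_def Least_le)
  define v where "v = (p ^^ N) x"
  define A where "A = (k - 1) / (m v * k powi lev v)"
  \<comment> \<open>The majorant is indexed so that \<open>d (Suc n)\<close> bounds term \<open>n\<close>: the first term that can be
    nonzero has index \<open>N - 1\<close>, which does not exist for \<open>N = 0\<close>; the value \<open>d 0\<close> is then merely dropped.\<close>
  define d where "d j = (if j < N then 0 else A * (1 / k) ^ (j - N))" for j
  have A: "0 \<le> A" using k m_pos[of v] by (simp add: A_def)
  have "(\<lambda>i. d (i + N)) sums (A * (1 / (1 - 1 / k)))"
    unfolding d_def using k sums_mult[OF geometric_sums[of "1 / k"], of A] by simp
  then have "d sums (A * (1 / (1 - 1 / k)))"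
    by (subst (asm) sums_zero_iff_shift) (auto simp: d_def)
  also have "A * (1 / (1 - 1 / k)) = k / (m v * k powi lev v)"
    using k m_pos[of v] by (simp add: A_def field_simps)
  finally have d: "d sums (k / (m v * k powi lev v))" .
  have sum_d: "summable (\<lambda>n. d (Suc n))" "(\<Sum>n. d (Suc n)) \<le> k / (m v * k powi lev v)"
  proof -
    show "summable (\<lambda>n. d (Suc n))"
      using d by (simp add: summable_Suc_iff sums_iff)
    have "0 \<le> d 0" using A by (simp add: d_def)
    then show "(\<Sum>n. d (Suc n)) \<le> k / (m v * k powi lev v)"
      using d suminf_split_head[of d] by (simp add: sums_iff)
  qed
  have Psi: "\<bar>Psi E \<omega> m ((p ^^ (n + 1)) x) ((p ^^ n) x) y\<bar> \<le> (if Suc n < N then 0 else 1 / m v)" for n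
  proof -
    consider "Suc n < N" | "Suc n = N" | "N \<le> n" by linarith
    then show ?thesis
    proof cases
      case 1
      then show ?thesis using Psi_outside N[of "Suc n"] by simp
    next
      case 2
      then have "y \<notin> subtree E \<omega> ((p ^^ n) x)" "v = p ((p ^^ n) x)" "(p ^^ N) x = p ((p ^^ n) x)"
        using N[of n] by (auto simp: v_def)
      then show ?thesis using abs_Psi_le(2)[of y "(p ^^ n) x"] 2 by simp
    next
      case 3
      then have "\<bar>Psi E \<omega> m (p ((p ^^ n) x)) ((p ^^ n) x) y\<bar> \<le> 1 / m ((p ^^ n) x)"
        using N[of n] abs_Psi_le(1) by simp
      also have "\<dots> \<le> 1 / m v"
        using m_ancestor_mono[OF 3, of x] m_pos[of v] by (simp add: v_def frac_le)
      finally show ?thesis using 3 by simp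
    qed
  qed
  have term_le: "norm (Psi E \<omega> m ((p ^^ (n + 1)) x) ((p ^^ n) x) y / S_sum E \<omega> (\<lambda>n. k powi n) (int n) x)
      \<le> d (Suc n)" for n
  proof (cases "Suc n < N")
    case True
    then show ?thesis using Psi[of n] by (simp add: d_def)
  next
    case False
    have "lev v = lev x + int N" by (simp add: v_def level_ancestor)
    then have e: "lev x + int n + 1 = lev v + int (Suc n - N)" using False by simp
    have S: "S_sum E \<omega> (\<lambda>n. k powi n) (int n) x = k powi (lev x + int n) * (k / (k - 1))"
      by (rule S_sum_exponential[OF k])
    also have "k powi (lev x + int n) * (k / (k - 1)) = k powi (lev x + int n + 1) / (k - 1)"
      using k by (simp add: power_int_add)
    also have "\<dots> = k powi lev v * k ^ (Suc n - N) / (k - 1)"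
      unfolding e using k by (simp add: power_int_add)
    finally have S: "S_sum E \<omega> (\<lambda>n. k powi n) (int n) x = k powi lev v * k ^ (Suc n - N) / (k - 1)" .
    have Spos: "0 < S_sum E \<omega> (\<lambda>n. k powi n) (int n) x"
      unfolding S using k by simp
    have "norm (Psi E \<omega> m ((p ^^ (n + 1)) x) ((p ^^ n) x) y / S_sum E \<omega> (\<lambda>n. k powi n) (int n) x)
       \<le> (1 / m v) / S_sum E \<omega> (\<lambda>n. k powi n) (int n) x"
      using divide_right_mono[OF Psi[of n] less_imp_le[OF Spos]] False Spos by (simp add: abs_divide)
    also have "\<dots> = d (Suc n)"
      unfolding S using k False by (simp add: d_def A_def field_simps power_one_over)
    finally show ?thesis .
  qed
  have "\<bar>bergman_kernel E \<omega> m (\<lambda>n. k powi n) x y\<bar> \<le> (\<Sum>n. d (Suc n))"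
    unfolding bergman_kernel_def real_norm_def[symmetric]
    by (rule norm_suminf_le[OF term_le sum_d(1)])
  with sum_d(2) have "\<bar>bergman_kernel E \<omega> m (\<lambda>n. k powi n) x y\<bar> \<le> k / (m v * k powi lev v)"
    by linarith
  then show thesis using N[of N] by (intro that[of N]) (simp_all add: v_def)
qed

section \<open>Summation over descendants and ancestors\<close>

lemma finite_nth_succs: "finite (nth_succs E \<omega> n v)"
  by (induction n) (auto simp: finite_succs)

text \<open>In \<open>(m x)\<^sup>2\<close> one factor is spent on the decay of \<open>m\<close> by \<open>D\<close> per generation, while the other
  sums up to the mass of the parent by the flow property.\<close>

lemma sum_square_nth_succs:
  assumes D: "\<And>x. m x \<le> D * m (p x)" "0 \<le> D"
  shows "(\<Sum>x\<in>nth_succs E \<omega> n v. (m x)\<^sup>2) \<le> D ^ n * (m v)\<^sup>2"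
proof (induction n)
  case (Suc n)
  have "(\<Sum>x\<in>nth_succs E \<omega> (Suc n) v. (m x)\<^sup>2)
      = (\<Sum>u\<in>nth_succs E \<omega> n v. \<Sum>x\<in>succs E \<omega> u. (m x)\<^sup>2)"
    by (simp, rule sum.UNION_disjoint) (auto simp: finite_nth_succs finite_succs in_succs_iff)
  also have "\<dots> \<le> (\<Sum>u\<in>nth_succs E \<omega> n v. D * (m u)\<^sup>2)"
  proof (rule sum_mono)
    fix u
    have "(\<Sum>x\<in>succs E \<omega> u. (m x)\<^sup>2) \<le> (\<Sum>x\<in>succs E \<omega> u. (D * m u) * m x)"
      using D(1) m_pos
      by (intro sum_mono) (auto simp: in_succs_iff power2_eq_square less_imp_le intro!: mult_right_mono)
    also have "\<dots> = D * (m u)\<^sup>2"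
      by (simp add: m_flow power2_eq_square flip: sum_distrib_left)
    finally show "(\<Sum>x\<in>succs E \<omega> u. (m x)\<^sup>2) \<le> D * (m u)\<^sup>2" .
  qed
  also have "\<dots> = D * (\<Sum>u\<in>nth_succs E \<omega> n v. (m u)\<^sup>2)"
    by (simp add: sum_distrib_left)
  also have "\<dots> \<le> D * (D ^ n * (m v)\<^sup>2)"
    using Suc.IH D(2) by (rule mult_left_mono)
  finally show ?case by simp
qed simp

text \<open>The generation \<open>n\<close> steps below \<open>v\<close> contributes at most \<open>(D / r) ^ n\<close> times the weight of \<open>v\<close>, the
  factor \<open>r ^ n\<close> coming from the drop of the level; the series over \<open>n\<close> converges because \<open>D < r\<close>.\<close>

lemma subtree_weight_bound:
  assumes D: "\<And>x. m x \<le> D * m (p x)" "0 \<le> D" and r: "D < r"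
  shows "(\<integral>\<^sup>+x. ennreal ((m x)\<^sup>2 * r powi lev x) * indicator (subtree E \<omega> v) x \<partial>count_space UNIV)
      \<le> ennreal ((m v)\<^sup>2 * r powi lev v / (1 - D / r))"
proof -
  have rpos: "0 < r" using D(2) r by simp
  let ?g = "\<lambda>x. ennreal ((m x)\<^sup>2 * r powi lev x)"
  have "(\<integral>\<^sup>+x. ?g x * indicator (subtree E \<omega> v) x \<partial>count_space UNIV)
     \<le> (\<integral>\<^sup>+x. (\<Sum>n. ?g x * indicator (nth_succs E \<omega> n v) x) \<partial>count_space UNIV)"
  proof (rule nn_integral_mono)
    fix x
    show "?g x * indicator (subtree E \<omega> v) x \<le> (\<Sum>n. ?g x * indicator (nth_succs E \<omega> n v) x)"
    proof (cases "x \<in> subtree E \<omega> v")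
      case True
      then obtain n where n: "x \<in> nth_succs E \<omega> n v" by (auto simp: subtree_def)
      have "?g x * indicator (nth_succs E \<omega> n v) x \<le> (\<Sum>n. ?g x * indicator (nth_succs E \<omega> n v) x)"
        by (rule ennreal_term_le_suminf)
      with n True show ?thesis by simp
    qed simp
  qed
  also have "\<dots> = (\<Sum>n. \<integral>\<^sup>+x. ?g x * indicator (nth_succs E \<omega> n v) x \<partial>count_space UNIV)"
    by (rule nn_integral_suminf) simp
  also have "\<dots> \<le> (\<Sum>n. ennreal ((m v)\<^sup>2 * r powi lev v * (D / r) ^ n))"
  proof (intro suminf_le allI)
    fix n
    have lev: "lev x = lev v - int n" if "x \<in> nth_succs E \<omega> n v" for x
      using that level_ancestor[of n x] by (auto simp: in_nth_succs_iff)
    have "(\<integral>\<^sup>+x. ?g x * indicator (nth_succs E \<omega> n v) x \<partial>count_space UNIV)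
        = (\<Sum>x\<in>nth_succs E \<omega> n v. ?g x)"
      using finite_nth_succs[of n v]
      by (simp add: nn_integral_count_space_indicator[symmetric] nn_integral_count_space_finite)
    also have "\<dots> = ennreal (\<Sum>x\<in>nth_succs E \<omega> n v. (m x)\<^sup>2 * r powi lev x)"
      using rpos by (intro sum_ennreal) simp
    also have "(\<Sum>x\<in>nth_succs E \<omega> n v. (m x)\<^sup>2 * r powi lev x)
        = (\<Sum>x\<in>nth_succs E \<omega> n v. (m x)\<^sup>2) * (r powi lev v / r ^ n)"
      using rpos by (simp add: sum_distrib_right sum_divide_distrib lev power_int_diff cong: sum.cong)
    also have "ennreal \<dots> \<le> ennreal (D ^ n * (m v)\<^sup>2 * (r powi lev v / r ^ n))"
      using rpos by (intro ennreal_leI mult_right_mono sum_square_nth_succs D) simp_all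
    also have "D ^ n * (m v)\<^sup>2 * (r powi lev v / r ^ n) = (m v)\<^sup>2 * r powi lev v * (D / r) ^ n"
      by (simp add: power_divide)
    finally show "(\<integral>\<^sup>+x. ?g x * indicator (nth_succs E \<omega> n v) x \<partial>count_space UNIV)
        \<le> ennreal ((m v)\<^sup>2 * r powi lev v * (D / r) ^ n)" .
  qed simp_all
  also have "\<dots> = ennreal ((m v)\<^sup>2 * r powi lev v * (1 / (1 - D / r)))"
    using D(2) rpos r by (intro suminf_ennreal_eq sums_mult geometric_sums) (simp_all)
  finally show ?thesis by simp
qed

lemma m_ancestor_le:
  assumes K: "\<And>x. m (p x) \<le> K * m x" "0 \<le> K"
  shows "m ((p ^^ n) x) \<le> K ^ n * m x"
proof (induction n)
  case (Suc n)
  have "m ((p ^^ Suc n) x) \<le> K * m ((p ^^ n) x)" using K(1) by simp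
  also have "\<dots> \<le> K * (K ^ n * m x)" using Suc.IH K(2) by (rule mult_left_mono)
  finally show ?case by simp
qed simp

text \<open>Every \<open>x\<close> lies below the ancestor \<open>v\<close> of \<open>y\<close> at which the kernel was estimated, so the column
  of \<open>y\<close> is covered by the subtrees of the ancestors of \<open>y\<close>. The subtree of \<open>v\<close> contributes a multiple
  of \<open>(m v)\<^sup>2 * r powi lev v / (m v * k powi lev v)\<close>, that is of \<open>m v * (r / k) powi lev v\<close>. One step
  upwards multiplies this by at most \<open>K * r / k < 1\<close>, so the sum over the ancestors converges and is
  governed by \<open>y\<close> itself. That the subtrees overlap costs only a constant.\<close>

lemma kernel_column_bound:
  assumes k: "1 < k" and D: "\<And>x. m x \<le> D * m (p x)" "0 \<le> D" "D < r"
    and K: "\<And>x. m (p x) \<le> K * m x" "0 \<le> K" "K * r < k"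
  shows "(\<integral>\<^sup>+x. ennreal ((m x)\<^sup>2 * r powi lev x * \<bar>bergman_kernel E \<omega> m (\<lambda>n. k powi n) x y\<bar>)
            \<partial>count_space UNIV)
      \<le> ennreal (k / (1 - D / r) / (1 - K * r / k) * (m y * (r / k) powi lev y))"
proof -
  have rpos: "0 < r" and kpos: "0 < k" using D k by simp_all
  have q: "0 < 1 - D / r" using D rpos by simp
  let ?g = "\<lambda>x. (m x)\<^sup>2 * r powi lev x"
  let ?c = "\<lambda>v. k / (m v * k powi lev v)"
  let ?T = "\<lambda>j. subtree E \<omega> ((p ^^ j) y)"
  have c: "0 \<le> ?c v" for v using kpos m_pos[of v] by simp
  have g: "0 \<le> ?g v" for v using rpos by simp
  have "(\<integral>\<^sup>+x. ennreal (?g x * \<bar>bergman_kernel E \<omega> m (\<lambda>n. k powi n) x y\<bar>) \<partial>count_space UNIV)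
      \<le> (\<integral>\<^sup>+x. (\<Sum>j. ennreal (?c ((p ^^ j) y)) * (ennreal (?g x) * indicator (?T j) x)) \<partial>count_space UNIV)"
  proof (rule nn_integral_mono)
    fix x
    obtain N where N: "y \<in> subtree E \<omega> ((p ^^ N) x)"
      "\<bar>bergman_kernel E \<omega> m (\<lambda>n. k powi n) x y\<bar> \<le> ?c ((p ^^ N) x)"
      by (rule bergman_kernel_bound[OF k])
    then obtain j where j: "(p ^^ j) y = (p ^^ N) x" by (auto simp: in_subtree_iff)
    then have x: "x \<in> ?T j" unfolding in_subtree_iff by auto
    have "ennreal (?g x * \<bar>bergman_kernel E \<omega> m (\<lambda>n. k powi n) x y\<bar>) \<le> ennreal (?g x * ?c ((p ^^ j) y))"
      using N(2) j g by (intro ennreal_leI mult_left_mono) simp_all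
    also have "\<dots> = ennreal (?g x) * ennreal (?c ((p ^^ j) y))"
      by (rule ennreal_mult[OF g c])
    also have "\<dots> = ennreal (?c ((p ^^ j) y)) * (ennreal (?g x) * indicator (?T j) x)"
      using x by (simp add: mult.commute)
    also have "\<dots> \<le> (\<Sum>j. ennreal (?c ((p ^^ j) y)) * (ennreal (?g x) * indicator (?T j) x))"
      by (rule ennreal_term_le_suminf)
    finally show "ennreal (?g x * \<bar>bergman_kernel E \<omega> m (\<lambda>n. k powi n) x y\<bar>)
        \<le> (\<Sum>j. ennreal (?c ((p ^^ j) y)) * (ennreal (?g x) * indicator (?T j) x))" .
  qed
  also have "\<dots> = (\<Sum>j. ennreal (?c ((p ^^ j) y)) * (\<integral>\<^sup>+x. ennreal (?g x) * indicator (?T j) x \<partial>count_space UNIV))"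
    by (simp add: nn_integral_suminf nn_integral_cmult)
  also have "\<dots> \<le> (\<Sum>j. ennreal (k / (1 - D / r) * (m y * (r / k) powi lev y) * (K * r / k) ^ j))"
  proof (intro suminf_le allI)
    fix j
    let ?v = "(p ^^ j) y"
    have "ennreal (?c ?v) * (\<integral>\<^sup>+x. ennreal (?g x) * indicator (?T j) x \<partial>count_space UNIV)
        \<le> ennreal (?c ?v) * ennreal (?g ?v / (1 - D / r))"
      by (intro mult_left_mono subtree_weight_bound D) simp
    also have "\<dots> = ennreal (?c ?v * (?g ?v / (1 - D / r)))"
      using c g q by (intro ennreal_mult[symmetric] divide_nonneg_pos[of "?g _"])
    also have "?c ?v * (?g ?v / (1 - D / r)) = k / (1 - D / r) * (m ?v * (r / k) powi lev ?v)"
      using m_pos[of ?v] kpos q by (simp add: power_int_divide_distrib power2_eq_square field_simps)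
    also have "ennreal \<dots> \<le> ennreal (k / (1 - D / r) * (K ^ j * m y * (r / k) powi lev ?v))"
      using kpos rpos q
      by (intro ennreal_leI mult_left_mono mult_right_mono m_ancestor_le K) simp_all
    also have "(r / k) powi lev ?v = (r / k) powi lev y * (r / k) ^ j"
      using kpos rpos by (simp add: level_ancestor power_int_add)
    also have "k / (1 - D / r) * (K ^ j * m y * ((r / k) powi lev y * (r / k) ^ j))
        = k / (1 - D / r) * (m y * (r / k) powi lev y) * (K * r / k) ^ j"
      by (simp add: power_mult_distrib power_divide)
    finally show "ennreal (?c ?v) * (\<integral>\<^sup>+x. ennreal (?g x) * indicator (?T j) x \<partial>count_space UNIV)
       \<le> ennreal (k / (1 - D / r) * (m y * (r / k) powi lev y) * (K * r / k) ^ j)" .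
  qed simp_all
  also have "\<dots> = ennreal (k / (1 - D / r) * (m y * (r / k) powi lev y) * (1 / (1 - K * r / k)))"
    using K kpos rpos q m_pos[of y]
    by (intro suminf_ennreal_eq sums_mult geometric_sums) (simp_all add: less_imp_le)
  finally show ?thesis by simp
qed

end

section \<open>Boundedness of the operator\<close>

theorem proposition3p6:
  fixes E :: "'v \<Rightarrow> 'v \<Rightarrow> bool" and x\<^sub>0 :: 'v and \<omega> :: "(nat \<Rightarrow> 'v) set"
    and m :: "'v \<Rightarrow> real"
    and ka kb kc kd C :: real
    and \<sigma>a \<sigma>b \<sigma>c \<sigma>d :: "int \<Rightarrow> real"
  assumes "is_tree E" and "infinite (UNIV :: 'v set)" and "locally_finite E"
    and "\<omega> \<in> tree_boundary E x\<^sub>0"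
    and "\<forall>x. 2 \<le> card (succs E \<omega> x)"
    and "flow_measure E \<omega> m"
    and "bdd_above (range (\<lambda>x. m (parent E \<omega> x) / m x))"
    and "0 < ka" and "0 < kb" and "0 < kd" and "1 < kc"
    and "\<forall>n. \<sigma>a n = ka powi n" and "\<forall>n. \<sigma>b n = kb powi n"
    and "\<forall>n. \<sigma>c n = kc powi n" and "\<forall>n. \<sigma>d n = kd powi n"
    and "0 < C" and "\<forall>x. m x \<le> C * (kc / (ka * kb)) powi level E \<omega> x"
    and "(SUP x. m x / m (parent E \<omega> x)) < ka * kd"
    and "ka * kd < kc / (SUP x. m (parent E \<omega> x) / m x)"
  shows "V_bounded_on_L1 E \<omega> m \<sigma>a \<sigma>b \<sigma>c \<sigma>d"
proof -
  interpret flow_tree E x\<^sub>0 \<omega> m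
    using assms(1,4,6) by unfold_locales
  define D where "D = (SUP x. m x / m (p x))"
  define K where "K = (SUP x. m (p x) / m x)"
  define r where "r = ka * kd"
  have D: "m x \<le> D * m (p x)" for x
  proof -
    have "bdd_above (range (\<lambda>x. m x / m (p x)))"
      using m_le_parent m_pos by (intro bdd_aboveI[of _ 1]) (auto simp: divide_le_eq_1)
    then have "m x / m (p x) \<le> D"
      unfolding D_def by (intro cSUP_upper) auto
    then show ?thesis using m_pos[of "p x"] by (simp add: field_simps)
  qed
  have K: "m (p x) \<le> K * m x" for x
  proof -
    have "m (p x) / m x \<le> K"
      unfolding K_def using assms(7) by (intro cSUP_upper) auto
    then show ?thesis using m_pos[of x] by (simp add: field_simps)
  qed
  have pos: "0 < D" "0 < K"
    using zero_less_mult_pos2[OF order_less_le_trans[OF m_pos D] m_pos]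
      zero_less_mult_pos2[OF order_less_le_trans[OF m_pos K] m_pos] by auto
  have r: "D < r" "K * r < kc"
    using assms(18,19) pos by (simp_all add: D_def[symmetric] K_def[symmetric] r_def field_simps)
  define B where "B = kc / (1 - D / r) / (1 - K * r / kc)"
  have B: "0 \<le> B"
    using r pos assms(11) by (simp add: B_def)
  have \<sigma>: "\<sigma>a = (\<lambda>n. ka powi n)" "\<sigma>b = (\<lambda>n. kb powi n)" "\<sigma>c = (\<lambda>n. kc powi n)" "\<sigma>d = (\<lambda>n. kd powi n)"
    using assms(12-15) by auto
  define w where "w x = m x * kd powi lev x" for x
  define k where "k x y = m x * ka powi lev x *
    (\<bar>bergman_kernel E \<omega> m \<sigma>c x y\<bar> * (m y * kb powi lev y))" for x y
  have w: "0 < w x" and k: "0 \<le> k x y" for x y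
    using m_pos[of x] m_pos[of y] assms(8,9,10) by (simp_all add: w_def k_def)
  have column: "(\<integral>\<^sup>+x. ennreal (w x * k x y) \<partial>count_space UNIV) \<le> ennreal (B * C * w y)" for y
  proof -
    let ?b = "m y * kb powi lev y"
    let ?h = "\<lambda>x. (m x)\<^sup>2 * r powi lev x * \<bar>bergman_kernel E \<omega> m (\<lambda>n. kc powi n) x y\<bar>"
    have b: "0 \<le> ?b" using m_pos[of y] assms(9) by simp
    have "w x * k x y = ?b * ?h x" for x
      by (simp add: w_def k_def r_def \<sigma> power_int_mult_distrib power2_eq_square)
    then have "(\<integral>\<^sup>+x. ennreal (w x * k x y) \<partial>count_space UNIV)
        = ennreal ?b * (\<integral>\<^sup>+x. ennreal (?h x) \<partial>count_space UNIV)"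
      using b by (simp add: ennreal_mult' nn_integral_cmult)
    also have "\<dots> \<le> ennreal ?b * ennreal (B * (m y * (r / kc) powi lev y))"
      unfolding B_def using r pos K D assms(11)
      by (intro mult_left_mono kernel_column_bound) (auto simp: less_imp_le)
    also have "\<dots> = ennreal (?b * (B * (m y * (r / kc) powi lev y)))"
      using b by (simp add: ennreal_mult')
    also have "?b * (B * (m y * (r / kc) powi lev y))
        = B * (m y * (kb * r / kc) powi lev y * m y)"
      by (simp add: power_int_mult_distrib power_int_divide_distrib)
    \<comment> \<open>The growth condition on \<open>m\<close> absorbs one of the two factors \<open>m y\<close> and turns the base of the
      power into \<open>kd\<close>.\<close>
    also have "\<dots> \<le> B * (C * (kc / (ka * kb)) powi lev y * (kb * r / kc) powi lev y * m y)"
      using assms(17)[rule_format, of y] m_pos[of y] B r pos assms(9,11)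
      by (intro mult_left_mono mult_right_mono) simp_all
    also have "\<dots> = B * C * w y"
    proof -
      have "kc / (ka * kb) * (kb * r / kc) = kd"
        using assms(8,9,11) by (simp add: r_def)
      then show ?thesis
        by (simp add: w_def mult.assoc flip: power_int_mult_distrib)
    qed
    finally show ?thesis by (simp add: ennreal_leI)
  qed
  have M: "weighted_measure E \<omega> m \<sigma>d = point_measure UNIV (\<lambda>x. ennreal (w x))"
    by (simp add: weighted_measure_def w_def \<sigma>)
  have summand: "of_real (k x y) * f y = of_real (m x * ka powi lev x) * V_summand E \<omega> m \<sigma>b \<sigma>c f x y"
    for f x y
    by (simp add: k_def V_summand_def \<sigma>)
  have V: "V_op E \<omega> m \<sigma>a \<sigma>b \<sigma>c f = (\<lambda>x. \<Sum>\<^sub>\<infinity>y. of_real (k x y) * f y)" for f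
    unfolding V_op_def summand by (simp add: infsum_cmult_right' \<sigma>)
  show ?thesis
    unfolding V_bounded_on_L1_def Let_def M
  proof (intro exI[of _ "B * C"] allI impI conjI)
    fix f :: "'v \<Rightarrow> complex"
    assume f: "integrable (point_measure UNIV (\<lambda>x. ennreal (w x))) f"
    have BC: "0 \<le> B * C" using B assms(16) by simp
    note L1 = L1_boundedness_by_column_sums[OF w k BC column f]
    show "(\<lambda>y. norm (V_summand E \<omega> m \<sigma>b \<sigma>c f x y)) summable_on UNIV" for x
    proof -
      have "m x \<noteq> 0" "ka \<noteq> 0" using m_pos[of x] assms(8) by simp_all
      then show ?thesis
        using L1(1)[of x] unfolding summand norm_mult by (subst (asm) summable_on_cmult_right') auto
    qed
    show "integrable (point_measure UNIV (\<lambda>x. ennreal (w x))) (V_op E \<omega> m \<sigma>a \<sigma>b \<sigma>c f)"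
      unfolding V by (rule L1(2))
    show "(\<integral>x. norm (V_op E \<omega> m \<sigma>a \<sigma>b \<sigma>c f x) \<partial>point_measure UNIV (\<lambda>x. ennreal (w x)))
        \<le> B * C * (\<integral>x. norm (f x) \<partial>point_measure UNIV (\<lambda>x. ennreal (w x)))"
      unfolding V by (rule L1(3))
  qed
qed

end
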